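(* Let $T$ be a rooted tree with weight $\pi:T\to(0,\infty)$, $1<p<\infty$, $\frac1p+\frac1{p'}=1$, and let $\mu$ be a positive finite Borel measure on $\overline T$. If $\mu$ satisfies $$\sup_{x\in T}\frac{I^*\left([I^*\mu]^{p'}\pi^{1-p'}\right)(x)}{I^*\mu(x)}\le C_1(\mu)<\infty, \qquad(\ast)$$ then $\mu$ satisfies, for all closed sets $E\subseteq\overline T$, $$\mu(E)\le C_2(\mu)\,\mathrm{Cap}(E),\qquad(\ast\ast)$$ with a constant $C_2(\mu)\le p^{p-1}C_1(\mu)^{p-1}$. Conversely, if $(\ast\ast)$ holds for all closed $E\subseteq\overline T$ with some finite constant $C_2(\mu)$, then $(\ast)$ holds with some finite constant $C_1(\mu)$.
   Context: $T$ is a rooted tree with root $o$ in which every vertex has at least one and at most $N$ children ($N$ finite); $\partial T$ is the set of infinite geodesics from $o$, $\overline T=T\cup\partial T$. For $\xi\in\overline T$, $P(\xi)\subseteq T$ is the set of vertices of the geodesic from $o$ to $\xi$ (including $o$, and $\xi$ if $\xi\in T$); $S(x)=\{\xi\in\overline T:x\in P(\xi)\}$ for $x\in T$. $\overline T$ has the compact metrizable topology with basis the singletons $\{x\}$ and the sets $S(x)$, $x\in T$. For a measure $\mu$ on $\overline T$, $I^*\mu(x)=\mu(S(x))$; for a function $f\ge0$ on $T$, $I^*f(x)=\sum_{y\in T\cap S(x)}f(y)$. Quotients $0/0$ are read as $0$. $\mathrm{Cap}(E)=\inf\{\sum_{x\in T}\varphi(x)^p\pi(x):\ \varphi\ge0,\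 \sum_{y\in P(\xi)}\varphi(y)\ge1\ \forall\xi\in E\}$ for $E\subseteq\overline T$. *)

theory Defs
  imports "HOL-Analysis.Analysis"
begin

record 'v rooted_graph =
  verts :: "'v set"
  adj :: "'v \<Rightarrow> 'v \<Rightarrow> bool"
  origin :: 'v

definition simple_path :: "'v rooted_graph \<Rightarrow> 'v list \<Rightarrow> bool" where
  "simple_path T xs \<longleftrightarrow>
     xs \<noteq> [] \<and> set xs \<subseteq> verts T \<and> distinct xs \<and> successively (adj T) xs"

definition path_between :: "'v rooted_graph \<Rightarrow> 'v \<Rightarrow> 'v \<Rightarrow> 'v list \<Rightarrow> bool" where
  "path_between T x y xs \<longleftrightarrow> simple_path T xs \<and> hd xs = x \<and> last xs = y"

definition rooted_tree :: "'v rooted_graph \<Rightarrow> bool" where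
  "rooted_tree T \<longleftrightarrow>
     origin T \<in> verts T \<and>
     (\<forall>x y. adj T x y \<longrightarrow> x \<in> verts T \<and> y \<in> verts T \<and> x \<noteq> y \<and> adj T y x) \<and>
     (\<forall>x\<in>verts T. \<forall>y\<in>verts T. \<exists>!xs. path_between T x y xs)"

definition geodesic :: "'v rooted_graph \<Rightarrow> 'v \<Rightarrow> 'v \<Rightarrow> 'v list" where
  "geodesic T x y = (THE xs. path_between T x y xs)"

definition children :: "'v rooted_graph \<Rightarrow> 'v \<Rightarrow> 'v set" where
  "children T x = {y. adj T x y \<and> x \<in> set (geodesic T (origin T) y)}"

text \<open>In a tree, geodesics and simple paths coincide, so the infinite geodesics from the root
  are the sequences all of whose initial segments are simple paths.\<close>

definition boundary :: "'v rooted_graph \<Rightarrow> (nat \<Rightarrow> 'v) set" where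
  "boundary T = {\<gamma>. \<gamma> 0 = origin T \<and> (\<forall>n. simple_path T (map \<gamma> [0..<Suc n]))}"

datatype 'v point = Vertex 'v | End "nat \<Rightarrow> 'v"

definition tree_closure :: "'v rooted_graph \<Rightarrow> 'v point set" where
  "tree_closure T = Vertex ` verts T \<union> End ` boundary T"

primrec predecessors :: "'v rooted_graph \<Rightarrow> 'v point \<Rightarrow> 'v set" where
  "predecessors T (Vertex x) = set (geodesic T (origin T) x)"
| "predecessors T (End \<gamma>) = range \<gamma>"

definition successors :: "'v rooted_graph \<Rightarrow> 'v \<Rightarrow> 'v point set" where
  "successors T x = {\<xi> \<in> tree_closure T. x \<in> predecessors T \<xi>}"

text \<open>Two sets \<open>successors T x\<close>, \<open>successors T y\<close> of a tree are nested or disjoint, so the generating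
  family below is a basis and not merely a subbasis.  Its union is \<open>tree_closure T\<close>.\<close>

definition closure_topology :: "'v rooted_graph \<Rightarrow> 'v point topology" where
  "closure_topology T =
     topology_generated_by ((\<lambda>x. {Vertex x}) ` verts T \<union> successors T ` verts T)"

definition finite_borel_measure :: "'v rooted_graph \<Rightarrow> 'v point measure \<Rightarrow> bool" where
  "finite_borel_measure T \<mu> \<longleftrightarrow>
     finite_measure \<mu> \<and>
     sets \<mu> = sigma_sets (tree_closure T) {U. openin (closure_topology T) U}"

definition Istar_measure :: "'v rooted_graph \<Rightarrow> 'v point measure \<Rightarrow> 'v \<Rightarrow> real" where
  "Istar_measure T \<mu> x = measure \<mu> (successors T x)"

definition Istar :: "'v rooted_graph \<Rightarrow> ('v \<Rightarrow> ennreal) \<Rightarrow> 'v \<Rightarrow> ennreal" where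
  "Istar T f x = (\<Sum>\<^sub>\<infinity>y | y \<in> verts T \<and> Vertex y \<in> successors T x. f y)"

text \<open>Division on \<^typ>\<open>ennreal\<close> satisfies \<open>0 / 0 = 0\<close>, and \<open>a / 0 = \<infinity>\<close> for \<open>a > 0\<close>.\<close>

definition testing_sup ::
  "'v rooted_graph \<Rightarrow> ('v \<Rightarrow> real) \<Rightarrow> real \<Rightarrow> 'v point measure \<Rightarrow> ennreal" where
  "testing_sup T \<pi> p' \<mu> =
     (SUP x\<in>verts T.
        Istar T (\<lambda>y. ennreal (Istar_measure T \<mu> y powr p' * \<pi> y powr (1 - p'))) x
          / ennreal (Istar_measure T \<mu> x))"

definition admissible :: "'v rooted_graph \<Rightarrow> 'v point set \<Rightarrow> ('v \<Rightarrow> real) \<Rightarrow> bool" where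
  "admissible T E \<phi> \<longleftrightarrow>
     (\<forall>x\<in>verts T. 0 \<le> \<phi> x) \<and>
     (\<forall>\<xi>\<in>E. 1 \<le> (\<Sum>\<^sub>\<infinity>y\<in>predecessors T \<xi>. ennreal (\<phi> y)))"

definition capacity ::
  "'v rooted_graph \<Rightarrow> ('v \<Rightarrow> real) \<Rightarrow> real \<Rightarrow> 'v point set \<Rightarrow> ennreal" where
  "capacity T \<pi> p E =
     (INF \<phi>\<in>Collect (admissible T E). \<Sum>\<^sub>\<infinity>x\<in>verts T. ennreal (\<phi> x powr p * \<pi> x))"

end

(*
Write M(x) = mu(S(x)), w = M^p' pi^(1-p') and g(x) = mu(E \<inter> S(x)).

Testing implies capacity. For t > 0 the vertices with g >= t M lie below disjoint topmost ones, so
the testing condition gives these vertices w-mass at most C1 mu(E) / t. Integrating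
p' t^(p'-1) dt over [0,1] bounds the energy of mu restricted to E: the sum of g^p' pi^(1-p') is at
most p C1 mu(E). If phi is admissible for E, then mu(E) is at most the integral over E of the
potential of phi, which is the sum of phi g; Young's inequality, scaled so that the energy term
becomes mu(E) / p', leaves mu(E) <= (p C1)^(p-1) times the sum of phi^p pi.

Capacity implies testing. For a finite set F of vertices below x let f = M^(p'-1) pi^(1-p') on F.
Then the sum A of w over F equals both the sum of f^p pi and the integral over S(x) of the
potential of f. The superlevel sets of this potential are closed, because every S(y) is clopen, and
have capacity at most A / t^p. A dyadic layer-cake decomposition above a level l yields
A <= l M(x) + const l^(1-p) A, and l can be chosen, independently of x and F, so that the last term
is at most A / 2.
*)
theory Submission
  imports Defs
begin

subsection \<open>Geodesics and the topology of the closure\<close>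

context
  fixes T :: "'v rooted_graph"
  assumes tree: "rooted_tree T"
begin

lemma geodesic_path:
  assumes "x \<in> verts T"
  shows "path_between T (origin T) x (geodesic T (origin T) x)"
proof -
  have "\<exists>!xs. path_between T (origin T) x xs"
    using tree assms by (auto simp: rooted_tree_def)
  then show ?thesis
    unfolding geodesic_def by (rule theI')
qed

lemma geodesic_eqI:
  assumes "path_between T (origin T) x xs"
  shows "geodesic T (origin T) x = xs"
proof -
  have "x \<in> verts T"
    using assms last_in_set[of xs] by (auto simp: path_between_def simple_path_def)
  then have "\<exists>!xs. path_between T (origin T) x xs"
    using tree by (auto simp: rooted_tree_def)
  then show ?thesis
    unfolding geodesic_def using assms by (rule the1_equality)
qed

text \<open>An initial segment of a simple path is again one, so uniqueness makes it the geodesic to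
  its last vertex. Ancestors of a vertex thus correspond to prefixes of one list.\<close>

lemma geodesic_take:
  assumes "x \<in> verts T" and i: "i < length (geodesic T (origin T) x)"
  shows "geodesic T (origin T) (geodesic T (origin T) x ! i) = take (Suc i) (geodesic T (origin T) x)"
proof (rule geodesic_eqI)
  let ?xs = "geodesic T (origin T) x"
  have p: "path_between T (origin T) x ?xs"
    using assms(1) by (rule geodesic_path)
  then have "successively (adj T) (take (Suc i) ?xs @ drop (Suc i) ?xs)"
    by (simp add: path_between_def simple_path_def)
  then have "successively (adj T) (take (Suc i) ?xs)"
    by (simp only: successively_append_iff)
  then show "path_between T (origin T) (?xs ! i) (take (Suc i) ?xs)"
    using p i set_take_subset[of "Suc i" ?xs]
    by (auto simp: path_between_def simple_path_def last_conv_nth)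
qed

lemma geodesic_boundary:
  assumes "\<gamma> \<in> boundary T"
  shows "geodesic T (origin T) (\<gamma> n) = map \<gamma> [0..<Suc n]"
proof (rule geodesic_eqI)
  show "path_between T (origin T) (\<gamma> n) (map \<gamma> [0..<Suc n])"
    using assms by (simp add: path_between_def boundary_def hd_map del: upt_Suc) simp
qed

lemma boundary_in_verts: "\<gamma> \<in> boundary T \<Longrightarrow> \<gamma> n \<in> verts T"
  by (auto simp: boundary_def simple_path_def)

lemma predecessors_subset_verts:
  assumes "\<xi> \<in> tree_closure T"
  shows "predecessors T \<xi> \<subseteq> verts T"
  using assms geodesic_path boundary_in_verts
  by (fastforce simp: tree_closure_def path_between_def simple_path_def)

lemma self_in_predecessors: "x \<in> verts T \<Longrightarrow> x \<in> predecessors T (Vertex x)"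
  using geodesic_path[of x] last_in_set[of "geodesic T (origin T) x"]
  by (auto simp: path_between_def simple_path_def)

lemma origin_in_predecessors:
  assumes "\<xi> \<in> tree_closure T"
  shows "origin T \<in> predecessors T \<xi>"
proof (cases \<xi>)
  case (Vertex x)
  then have "path_between T (origin T) x (geodesic T (origin T) x)"
    using assms by (intro geodesic_path) (auto simp: tree_closure_def)
  then show ?thesis
    using Vertex hd_in_set[of "geodesic T (origin T) x"]
    by (simp add: path_between_def simple_path_def)
next
  case (End \<gamma>)
  then have "\<gamma> 0 = origin T" using assms by (auto simp: tree_closure_def boundary_def)
  then show ?thesis using End by (auto intro: range_eqI[of _ _ 0])
qed

lemma predecessors_vertex_cases:
  assumes "y \<in> verts T" "x \<in> predecessors T (Vertex y)"
  obtains i where "i < length (geodesic T (origin T) y)" "x = geodesic T (origin T) y ! i"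
    "geodesic T (origin T) x = take (Suc i) (geodesic T (origin T) y)"
  using assms geodesic_take by (auto simp: in_set_conv_nth)

lemma predecessors_trans:
  assumes "\<xi> \<in> tree_closure T" "x \<in> predecessors T \<xi>"
  shows "predecessors T (Vertex x) \<subseteq> predecessors T \<xi>"
proof (cases \<xi>)
  case (Vertex y)
  then have "y \<in> verts T" using assms by (auto simp: tree_closure_def)
  then show ?thesis using assms(2) unfolding Vertex
    by (rule predecessors_vertex_cases) (auto dest: in_set_takeD)
next
  case (End \<gamma>)
  then show ?thesis using assms geodesic_boundary
    by (auto simp: tree_closure_def simp del: upt_Suc)
qed

text \<open>Both geodesics are initial segments of the same one, so the shorter is a prefix of the
  longer. Hence two successor sets are nested or disjoint.\<close>

lemma predecessors_chain:
  assumes "\<xi> \<in> tree_closure T" "x \<in> predecessors T \<xi>" "y \<in> predecessors T \<xi>"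
  shows "x \<in> predecessors T (Vertex y) \<or> y \<in> predecessors T (Vertex x)"
proof (cases \<xi>)
  case (Vertex z)
  then have z: "z \<in> verts T" using assms by (auto simp: tree_closure_def)
  obtain i where i: "i < length (geodesic T (origin T) z)" "x = geodesic T (origin T) z ! i"
    "geodesic T (origin T) x = take (Suc i) (geodesic T (origin T) z)"
    using predecessors_vertex_cases z assms(2) Vertex by metis
  obtain j where j: "j < length (geodesic T (origin T) z)" "y = geodesic T (origin T) z ! j"
    "geodesic T (origin T) y = take (Suc j) (geodesic T (origin T) z)"
    using predecessors_vertex_cases z assms(3) Vertex by metis
  show ?thesis
  proof (cases "i \<le> j")
    case True
    then have "x = take (Suc j) (geodesic T (origin T) z) ! i" "i < Suc j" using i by auto
    then show ?thesis using j i True by (auto simp: in_set_conv_nth intro!: exI[of _ i])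
  next
    case False
    then have "y = take (Suc i) (geodesic T (origin T) z) ! j" "j < Suc i" using j by auto
    then show ?thesis using j i False by (auto simp: in_set_conv_nth intro!: exI[of _ j])
  qed
next
  case (End \<gamma>)
  then have \<gamma>: "\<gamma> \<in> boundary T" using assms by (auto simp: tree_closure_def)
  obtain i j where "x = \<gamma> i" "y = \<gamma> j" using assms End by auto
  then show ?thesis using geodesic_boundary[OF \<gamma>, of i] geodesic_boundary[OF \<gamma>, of j]
    by (cases "i \<le> j") (auto simp del: upt_Suc)
qed

text \<open>Geodesic length serves as a depth: it drops strictly at proper ancestors, since a prefix
  of full length has the same last vertex.\<close>

lemma predecessors_length:
  assumes "y \<in> verts T" "x \<in> predecessors T (Vertex y)"
  shows "x = y \<or> length (geodesic T (origin T) x) < length (geodesic T (origin T) y)"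
proof -
  obtain i where i: "i < length (geodesic T (origin T) y)" "x = geodesic T (origin T) y ! i"
    "geodesic T (origin T) x = take (Suc i) (geodesic T (origin T) y)"
    using assms by (rule predecessors_vertex_cases)
  have "last (geodesic T (origin T) y) = y"
    using geodesic_path[OF assms(1)] by (simp add: path_between_def)
  moreover have "geodesic T (origin T) y \<noteq> []" using i(1) by auto
  ultimately have "x = y" if "Suc i = length (geodesic T (origin T) y)"
    using i(2) that by (metis diff_Suc_1 last_conv_nth)
  then show ?thesis using i by fastforce
qed

lemma same_length_predecessors_eq:
  assumes "\<xi> \<in> tree_closure T" "x \<in> predecessors T \<xi>" "y \<in> predecessors T \<xi>"
    and "length (geodesic T (origin T) x) = length (geodesic T (origin T) y)"
  shows "x = y"
  using predecessors_chain[OF assms(1-3)] predecessors_length[of x y] predecessors_length[of y x]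
    predecessors_subset_verts[OF assms(1)] assms by fastforce

section \<open>Successor sets as clopen sets, and topmost vertices\<close>

lemma successors_subset_closure: "successors T x \<subseteq> tree_closure T"
  by (auto simp: successors_def)

lemma successors_origin: "successors T (origin T) = tree_closure T"
  using origin_in_predecessors by (auto simp: successors_def)

lemma origin_in_verts: "origin T \<in> verts T"
  using tree by (simp add: rooted_tree_def)

lemma successors_mono:
  assumes "Vertex y \<in> successors T x"
  shows "successors T y \<subseteq> successors T x"
  using assms predecessors_trans by (fastforce simp: successors_def)

lemma topspace_closure_topology [simp]: "topspace (closure_topology T) = tree_closure T"
  using successors_origin origin_in_verts successors_subset_closure
  by (auto simp: closure_topology_def tree_closure_def)

lemma openin_vertex: "x \<in> verts T \<Longrightarrow> openin (closure_topology T) {Vertex x}"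
  unfolding closure_topology_def by (intro topology_generated_by_Basis) auto

lemma openin_successors: "x \<in> verts T \<Longrightarrow> openin (closure_topology T) (successors T x)"
  unfolding closure_topology_def by (intro topology_generated_by_Basis) auto

text \<open>Points outside have open neighbourhoods missing the set: vertices are isolated, and an
  end passes through another vertex at the depth of \<open>x\<close>, whose successor set is
  disjoint from that of \<open>x\<close>.\<close>

lemma closedin_successors:
  assumes "x \<in> verts T"
  shows "closedin (closure_topology T) (successors T x)"
  unfolding closedin_def
proof
  show "successors T x \<subseteq> topspace (closure_topology T)"
    using successors_subset_closure by simp
  show "openin (closure_topology T) (topspace (closure_topology T) - successors T x)"
  proof (subst openin_subopen, intro ballI)
    fix \<xi> assume \<xi>: "\<xi> \<in> topspace (closure_topology T) - successors T x"
    show "\<exists>U. openin (closure_topology T) U \<and> \<xi> \<in> U \<and> U \<subseteq> topspace (closure_topology T) - successors T x"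
    proof (cases \<xi>)
      case (Vertex y)
      then have "openin (closure_topology T) {\<xi>}"
        using \<xi> openin_vertex by (auto simp: tree_closure_def)
      then show ?thesis using \<xi> by blast
    next
      case (End \<gamma>)
      then have \<gamma>: "\<gamma> \<in> boundary T" using \<xi> by (auto simp: tree_closure_def)
      \<comment> \<open>The geodesic to \<open>\<gamma> n\<close> has \<open>n + 1\<close> vertices,
        so the end reaches the depth of \<open>x\<close> at this index; the subtraction is exact
        because geodesics are nonempty.\<close>
      define n where "n = length (geodesic T (origin T) x) - 1"
      have "geodesic T (origin T) x \<noteq> []"
        using geodesic_path[OF assms] by (simp add: path_between_def simple_path_def)
      then have len: "length (geodesic T (origin T) (\<gamma> n)) = length (geodesic T (origin T) x)"
        using geodesic_boundary[OF \<gamma>, of n] by (simp add: n_def)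
      have "\<gamma> n \<noteq> x" using \<xi> End by (auto simp: successors_def)
      then have "successors T (\<gamma> n) \<inter> successors T x = {}"
        using same_length_predecessors_eq[OF _ _ _ len] by (auto simp: successors_def)
      moreover have "\<xi> \<in> successors T (\<gamma> n)" using \<xi> End by (auto simp: successors_def)
      ultimately show ?thesis
        using openin_successors boundary_in_verts[OF \<gamma>] successors_subset_closure[of "\<gamma> n"]
        by (intro exI[of _ "successors T (\<gamma> n)"]) auto
    qed
  qed
qed

text \<open>Among the members of \<open>G\<close> on the geodesic to \<open>x\<close>, take the one
  nearest the root. A member of \<open>G\<close> above it would lie on the same geodesic and be
  nearer still.\<close>

lemma minimal_predecessor:
  assumes "G \<subseteq> verts T" "x \<in> G"
  shows "\<exists>y\<in>G. Vertex x \<in> successors T y \<and> (\<forall>z\<in>G. z \<in> predecessors T (Vertex y) \<longrightarrow> z = y)"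
proof -
  let ?B = "\<lambda>y. y \<in> G \<and> y \<in> predecessors T (Vertex x)"
  define y where "y = arg_min (\<lambda>y. length (geodesic T (origin T) y)) ?B"
  have x: "?B x" using assms self_in_predecessors by auto
  then have y: "?B y" unfolding y_def by (rule arg_min_natI)
  have vert: "Vertex v \<in> tree_closure T" if "v \<in> G" for v
    using that assms by (auto simp: tree_closure_def)
  show ?thesis
  proof (intro bexI conjI ballI impI)
    show "y \<in> G" "Vertex x \<in> successors T y" using y vert assms by (auto simp: successors_def)
    fix z assume z: "z \<in> G" "z \<in> predecessors T (Vertex y)"
    then have "?B z" using predecessors_trans[OF vert[OF assms(2)], of y] y by auto
    then have "length (geodesic T (origin T) y) \<le> length (geodesic T (origin T) z)"
      unfolding y_def by (rule arg_min_nat_le)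
    then show "z = y" using predecessors_length[of y z] z y assms by auto
  qed
qed

end

subsection \<open>Sums, layer cakes and the energy bound\<close>

text \<open>Recasts vertex sums as count-space integrals, so that Tonelli and linearity of the
  integral apply.\<close>

lemma nn_integral_count_space_eq_infsum:
  fixes f :: "'a \<Rightarrow> ennreal"
  assumes "countable A"
  shows "(\<integral>\<^sup>+x. f x \<partial>count_space A) = infsum f A"
proof (cases "finite A")
  case True
  then show ?thesis by (simp add: nn_integral_count_space_finite)
next
  case False
  then have bij: "bij_betw (from_nat_into A) UNIV A"
    using assms by (intro bij_betw_from_nat_into)
  have "(\<lambda>n. f (from_nat_into A n)) sums infsum (\<lambda>n. f (from_nat_into A n)) UNIV"
    by (intro has_sum_imp_sums has_sum_infsum nonneg_summable_on_complete) simp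
  then show ?thesis
    using nn_integral_bij_count_space[OF bij, of f] infsum_reindex_bij_betw[OF bij, of f]
    by (simp add: nn_integral_count_space_nat sums_iff)
qed

lemma sum_le_infsum_ennreal:
  fixes f :: "'a \<Rightarrow> real"
  assumes "\<And>x. x \<in> A \<Longrightarrow> 0 \<le> f x" "finite F" "F \<subseteq> A"
  shows "ennreal (sum f F) \<le> (\<Sum>\<^sub>\<infinity>x\<in>A. ennreal (f x))"
proof -
  have "ennreal (sum f F) = (\<Sum>x\<in>F. ennreal (f x))"
    using assms by (intro sum_ennreal[symmetric]) auto
  also have "\<dots> \<le> (\<Sum>\<^sub>\<infinity>x\<in>A. ennreal (f x))"
    using assms by (subst nonneg_infsum_complete[of A]) (auto intro!: SUP_upper)
  finally show ?thesis .
qed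

text \<open>Supplies the countable index set for exchanging a vertex sum with an integral. The
  partial sums stay below the finite total, so the family is summable over the reals.\<close>

lemma countable_support_ennreal:
  fixes f :: "'a \<Rightarrow> real"
  assumes nonneg: "\<And>x. x \<in> A \<Longrightarrow> 0 \<le> f x" and fin: "(\<Sum>\<^sub>\<infinity>x\<in>A. ennreal (f x)) < \<infinity>"
  shows "countable {x \<in> A. f x \<noteq> 0}"
proof (rule summable_countable_real, rule nonneg_bdd_above_summable_on)
  show "bdd_above (sum f ` {F. F \<subseteq> A \<and> finite F})"
  proof (rule bdd_aboveI2)
    fix F assume "F \<in> {F. F \<subseteq> A \<and> finite F}"
    then have F: "F \<subseteq> A" "finite F" by auto
    have "ennreal (sum f F) \<le> (\<Sum>\<^sub>\<infinity>x\<in>A. ennreal (f x))"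
      using F nonneg by (intro sum_le_infsum_ennreal) auto
    then have "enn2real (ennreal (sum f F)) \<le> enn2real (\<Sum>\<^sub>\<infinity>x\<in>A. ennreal (f x))"
      using fin by (intro enn2real_mono) auto
    moreover have "0 \<le> sum f F" using F nonneg by (intro sum_nonneg) auto
    ultimately show "sum f F \<le> enn2real (\<Sum>\<^sub>\<infinity>x\<in>A. ennreal (f x))" by simp
  qed
qed (use nonneg in auto)

lemma infsum_ennreal_leI:
  fixes f :: "'a \<Rightarrow> real"
  assumes "\<And>x. x \<in> A \<Longrightarrow> 0 \<le> f x" "\<And>F. finite F \<Longrightarrow> F \<subseteq> A \<Longrightarrow> sum f F \<le> c"
  shows "(\<Sum>\<^sub>\<infinity>x\<in>A. ennreal (f x)) \<le> ennreal c"
proof -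
  have "(\<Sum>x\<in>F. ennreal (f x)) \<le> ennreal c" if "finite F" "F \<subseteq> A" for F
    using that assms by (subst sum_ennreal) (auto intro!: ennreal_leI)
  then show ?thesis
    by (subst nonneg_infsum_complete) (auto intro!: SUP_least)
qed

lemma dyadic_layer_bound:
  fixes s l :: real
  assumes "0 < l" "s \<le> 2 ^ K * l"
  shows "s \<le> l + (\<Sum>k<K. 2 ^ k * l * (if 2 ^ k * l \<le> s then 1 else 0))"
  using assms(2)
proof (induction K)
  case (Suc K)
  show ?case
  proof (cases "s \<le> 2 ^ K * l")
    case True
    then have "s \<le> l + (\<Sum>k<K. 2 ^ k * l * (if 2 ^ k * l \<le> s then 1 else 0))" by (rule Suc.IH)
    moreover have "0 \<le> 2 ^ K * l * (if 2 ^ K * l \<le> s then 1 else 0)" using assms(1) by simp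
    ultimately show ?thesis unfolding sum.lessThan_Suc by linarith
  next
    case False
    have "2 ^ k * l \<le> s" if "k < Suc K" for k
    proof -
      have "2 ^ k * l \<le> 2 ^ K * l" using that assms(1) by (intro mult_right_mono power_increasing) auto
      then show ?thesis using False by simp
    qed
    then have "(\<Sum>k<Suc K. 2 ^ k * l * (if 2 ^ k * l \<le> s then 1 else 0)) = (\<Sum>k<Suc K. 2 ^ k * l)"
      by (intro sum.cong) auto
    also have "\<dots> = (\<Sum>k<Suc K. 2 ^ k) * l" by (simp only: sum_distrib_right)
    also have "(\<Sum>k<Suc K. (2::real) ^ k) = 2 ^ Suc K - 1" by (subst geometric_sum) auto
    finally show ?thesis using Suc.prems by (simp add: algebra_simps)
  qed
qed (use assms in simp)

text \<open>Here \<open>h x powr q\<close> is the integral of \<open>q * t powr (q - 1)\<close> from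
  0 to \<open>h x\<close>. Under the integral the weak-type hypothesis leaves at most
  \<open>q * B * t powr (q - 2)\<close>, integrable at 0 because \<open>q > 1\<close>.\<close>

lemma powr_layer_cake_bound:
  fixes w h :: "'a \<Rightarrow> real" and q B :: real
  assumes F: "finite F" and q: "1 < q"
    and h: "\<And>x. x \<in> F \<Longrightarrow> 0 \<le> h x \<and> h x \<le> 1"
    and weak: "\<And>t. 0 < t \<Longrightarrow> sum w {x \<in> F. t \<le> h x} \<le> B / t"
  shows "(\<Sum>x\<in>F. w x * h x powr q) \<le> q / (q - 1) * B"
proof (rule has_integral_le)
  show "((\<lambda>t. \<Sum>x\<in>F. w x * (q * (if t \<in> {0..h x} then t powr (q - 1) else 0))) has_integral
      (\<Sum>x\<in>F. w x * h x powr q)) {0..1}"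
  proof (intro has_integral_sum F)
    fix x assume "x \<in> F"
    then have "((\<lambda>t. if t \<in> {0..h x} then t powr (q - 1) else 0) has_integral h x powr q / q) {0..1}"
      using h[of x] q has_integral_powr_from_0[of "q - 1" "h x"] by (subst has_integral_restrict) auto
    then have "((\<lambda>t. w x * (q * (if t \<in> {0..h x} then t powr (q - 1) else 0))) has_integral
        w x * (q * (h x powr q / q))) {0..1}"
      by (intro has_integral_mult_right)
    then show "((\<lambda>t. w x * (q * (if t \<in> {0..h x} then t powr (q - 1) else 0))) has_integral
        w x * h x powr q) {0..1}"
      using q by simp
  qed
  have "((\<lambda>t::real. t powr (q - 2)) has_integral 1 / (q - 1)) {0..1}"
    using q has_integral_powr_from_0[of "q - 2" 1] by simp
  then have "((\<lambda>t. q * B * t powr (q - 2)) has_integral q * B * (1 / (q - 1))) {0..1}"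
    by (rule has_integral_mult_right)
  then show "((\<lambda>t. q * B * t powr (q - 2)) has_integral q / (q - 1) * B) {0..1}"
    by (simp add: mult.commute)
  fix t :: real assume "t \<in> {0..1}"
  show "(\<Sum>x\<in>F. w x * (q * (if t \<in> {0..h x} then t powr (q - 1) else 0))) \<le> q * B * t powr (q - 2)"
  proof (cases "t = 0")
    \<comment> \<open>Both sides vanish, since \<open>0 powr a = 0\<close> for every
      \<open>a\<close>, including a negative \<open>q - 2\<close>.\<close>
    case True
    then show ?thesis by (simp del: atLeastAtMost_iff cong: if_cong)
  next
    case False
    then have t: "0 < t" using \<open>t \<in> {0..1}\<close> by simp
    have "(\<Sum>x\<in>F. w x * (q * (if t \<in> {0..h x} then t powr (q - 1) else 0))) =
        (\<Sum>x\<in>F. if t \<le> h x then q * t powr (q - 1) * w x else 0)"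
      using t by (intro sum.cong) auto
    also have "\<dots> = (\<Sum>x\<in>{x \<in> F. t \<le> h x}. q * t powr (q - 1) * w x)"
      using F by (rule sum.inter_filter[symmetric])
    also have "\<dots> = q * t powr (q - 1) * sum w {x \<in> F. t \<le> h x}"
      by (simp add: sum_distrib_left)
    also have "\<dots> \<le> q * t powr (q - 1) * (B / t)"
      using q t weak by (intro mult_left_mono) auto
    also have "\<dots> = q * B * t powr (q - 2)"
      using t powr_add[of t "q - 2" 1] by simp
    finally show ?thesis .
  qed
qed

section \<open>Weak-type and energy estimates under the testing condition\<close>

context
  fixes T :: "'v rooted_graph" and \<mu> :: "'v point measure"
  assumes tree: "rooted_tree T" and borel: "finite_borel_measure T \<mu>"
begin

lemma finite_mu: "finite_measure \<mu>"
  using borel by (simp add: finite_borel_measure_def)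

lemma sets_mu_openin: "openin (closure_topology T) U \<Longrightarrow> U \<in> sets \<mu>"
  using borel by (auto simp: finite_borel_measure_def)

text \<open>The definition prescribes only the sigma-algebra, so the space is recovered from it: the
  closure is measurable and contains every generator.\<close>

lemma space_mu: "space \<mu> = tree_closure T"
proof
  have "tree_closure T \<in> sets \<mu>"
    using sets_mu_openin[OF openin_topspace] by (simp add: topspace_closure_topology[OF tree])
  then show "tree_closure T \<subseteq> space \<mu>" by (rule sets.sets_into_space)
  have "U \<subseteq> tree_closure T" if "openin (closure_topology T) U" for U
    using openin_subset[OF that] by (simp add: topspace_closure_topology[OF tree])
  then have "{U. openin (closure_topology T) U} \<subseteq> Pow (tree_closure T)" by blast
  moreover have "space \<mu> \<in> sigma_sets (tree_closure T) {U. openin (closure_topology T) U}"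
    using borel sets.top[of \<mu>] by (simp add: finite_borel_measure_def)
  ultimately show "space \<mu> \<subseteq> tree_closure T" by (rule sigma_sets_into_sp)
qed

lemma sets_mu_closedin:
  assumes "closedin (closure_topology T) E"
  shows "E \<in> sets \<mu>"
proof -
  have "space \<mu> - (tree_closure T - E) \<in> sets \<mu>"
    using assms by (intro sets.compl_sets sets_mu_openin) (simp add: closedin_def topspace_closure_topology[OF tree])
  moreover have "space \<mu> - (tree_closure T - E) = E"
    using closedin_subset[OF assms] by (auto simp: space_mu topspace_closure_topology[OF tree])
  ultimately show ?thesis by simp
qed

lemma sets_mu_successors: "x \<in> verts T \<Longrightarrow> successors T x \<in> sets \<mu>"
  by (intro sets_mu_openin openin_successors tree)

text \<open>The sets \<open>successors T y\<close>, for \<open>y\<close> a topmost vertex of the summation set, are disjoint and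
  cover it, so the testing condition can be applied to each of them separately.\<close>

lemma carleson_weak_type:
  fixes w :: "'v \<Rightarrow> real"
  assumes F: "finite F" "F \<subseteq> verts T" and C: "0 \<le> C" and E: "E \<in> sets \<mu>"
    and testing: "\<And>x G. x \<in> verts T \<Longrightarrow> 0 < Istar_measure T \<mu> x \<Longrightarrow> finite G \<Longrightarrow> G \<subseteq> verts T \<Longrightarrow>
      Vertex ` G \<subseteq> successors T x \<Longrightarrow> sum w G \<le> C * Istar_measure T \<mu> x"
    and t: "0 < t"
  shows "sum w {x \<in> F. t \<le> measure \<mu> (E \<inter> successors T x) / Istar_measure T \<mu> x}
    \<le> C * measure \<mu> E / t"
proof -
  interpret finite_measure \<mu> by (rule finite_mu)
  define G where "G = {x \<in> F. t \<le> measure \<mu> (E \<inter> successors T x) / Istar_measure T \<mu> x}"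
  define m where "m = {y \<in> G. \<forall>z\<in>G. z \<in> predecessors T (Vertex y) \<longrightarrow> z = y}"
  have G: "G \<subseteq> verts T" "finite G" using F by (auto simp: G_def)
  have m: "m \<subseteq> verts T" "finite m" using G by (auto simp: m_def)
  have "\<forall>x\<in>G. \<exists>y. y \<in> m \<and> Vertex x \<in> successors T y"
  proof
    fix x assume "x \<in> G"
    from minimal_predecessor[OF tree G(1) this] obtain y where "y \<in> G" "Vertex x \<in> successors T y"
      "\<forall>z\<in>G. z \<in> predecessors T (Vertex y) \<longrightarrow> z = y"
      by (elim bexE conjE)
    then show "\<exists>y. y \<in> m \<and> Vertex x \<in> successors T y"
      unfolding m_def by (intro exI[of _ y] conjI CollectI)
  qed
  then obtain r where "\<forall>x\<in>G. r x \<in> m \<and> Vertex x \<in> successors T (r x)"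
    by (rule bchoice[elim_format]) blast
  then have r: "\<And>x. x \<in> G \<Longrightarrow> r x \<in> m" "\<And>x. x \<in> G \<Longrightarrow> Vertex x \<in> successors T (r x)"
    by auto
  have disj: "disjoint_family_on (\<lambda>y. E \<inter> successors T y) m"
    unfolding disjoint_family_on_def
  proof (intro ballI impI)
    fix y z assume yz: "y \<in> m" "z \<in> m" "y \<noteq> z"
    have False if "\<xi> \<in> successors T y" "\<xi> \<in> successors T z" for \<xi>
    proof -
      have "y \<in> predecessors T (Vertex z) \<or> z \<in> predecessors T (Vertex y)"
        using that by (intro predecessors_chain[OF tree, of \<xi>]) (auto simp: successors_def)
      then show False using yz unfolding m_def by blast
    qed
    then show "(E \<inter> successors T y) \<inter> (E \<inter> successors T z) = {}" by blast
  qed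
  \<comment> \<open>The fibres of \<open>r\<close> split \<open>G\<close> into pieces, each below a
    single topmost vertex.\<close>
  have "sum w G = (\<Sum>y\<in>m. sum w {x \<in> G. r x = y})"
    using G m r by (intro sum.group[symmetric]) auto
  also have "\<dots> \<le> (\<Sum>y\<in>m. C / t * measure \<mu> (E \<inter> successors T y))"
  proof (rule sum_mono)
    fix y assume y: "y \<in> m"
    then have h: "t \<le> measure \<mu> (E \<inter> successors T y) / Istar_measure T \<mu> y"
      by (simp add: m_def G_def)
    \<comment> \<open>A zero mass would make the quotient in \<open>h\<close> equal to 0,
      contradicting \<open>0 < t\<close>.\<close>
    have pos: "0 < Istar_measure T \<mu> y"
      using h t by (cases "Istar_measure T \<mu> y = 0") (auto simp: Istar_measure_def zero_less_measure_iff)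
    have "sum w {x \<in> G. r x = y} \<le> C * Istar_measure T \<mu> y"
      using y m G r pos by (intro testing) auto
    also have "\<dots> \<le> C * (measure \<mu> (E \<inter> successors T y) / t)"
      using h pos t C by (intro mult_left_mono) (auto simp: field_simps)
    finally show "sum w {x \<in> G. r x = y} \<le> C / t * measure \<mu> (E \<inter> successors T y)" by simp
  qed
  also have "\<dots> = C / t * (\<Sum>y\<in>m. measure \<mu> (E \<inter> successors T y))" by (simp add: sum_distrib_left)
  also have "(\<Sum>y\<in>m. measure \<mu> (E \<inter> successors T y)) = measure \<mu> (\<Union>y\<in>m. E \<inter> successors T y)"
    using m E sets_mu_successors disj by (intro finite_measure_finite_Union[symmetric]) auto
  also have "C / t * measure \<mu> (\<Union>y\<in>m. E \<inter> successors T y) \<le> C / t * measure \<mu> E"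
    using E C t by (intro mult_left_mono finite_measure_mono) auto
  finally show ?thesis by (simp add: G_def)
qed

text \<open>Each summand is the weight \<open>Istar_measure T \<mu> y powr q * \<sigma> y\<close>
  times the \<open>q\<close>-th power of the ratio of restricted to full mass. The weak-type
  estimate for this weight feeds the layer-cake bound.\<close>

lemma energy_bound:
  fixes \<sigma> :: "'v \<Rightarrow> real"
  assumes F: "finite F" "F \<subseteq> verts T" and C: "0 \<le> C" and E: "E \<in> sets \<mu>" and q: "1 < q"
    and testing: "\<And>x G. x \<in> verts T \<Longrightarrow> 0 < Istar_measure T \<mu> x \<Longrightarrow> finite G \<Longrightarrow> G \<subseteq> verts T \<Longrightarrow>
      Vertex ` G \<subseteq> successors T x \<Longrightarrow>
      (\<Sum>y\<in>G. Istar_measure T \<mu> y powr q * \<sigma> y) \<le> C * Istar_measure T \<mu> x"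
  shows "(\<Sum>y\<in>F. measure \<mu> (E \<inter> successors T y) powr q * \<sigma> y) \<le> q / (q - 1) * (C * measure \<mu> E)"
proof -
  interpret finite_measure \<mu> by (rule finite_mu)
  let ?h = "\<lambda>y. measure \<mu> (E \<inter> successors T y) / Istar_measure T \<mu> y"
  have le: "measure \<mu> (E \<inter> successors T y) \<le> Istar_measure T \<mu> y" if "y \<in> F" for y
    unfolding Istar_measure_def using that F sets_mu_successors by (intro finite_measure_mono) auto
  have "(\<Sum>y\<in>F. measure \<mu> (E \<inter> successors T y) powr q * \<sigma> y) =
      (\<Sum>y\<in>F. Istar_measure T \<mu> y powr q * \<sigma> y * ?h y powr q)"
  proof (rule sum.cong)
    fix y assume "y \<in> F"
    show "measure \<mu> (E \<inter> successors T y) powr q * \<sigma> y =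
        Istar_measure T \<mu> y powr q * \<sigma> y * ?h y powr q"
    proof (cases "Istar_measure T \<mu> y = 0")
      \<comment> \<open>The restricted mass is 0 too, so both sides vanish because
        \<open>0 powr q = 0\<close>.\<close>
      case True
      then show ?thesis using le[OF \<open>y \<in> F\<close>] measure_nonneg[of \<mu> "E \<inter> successors T y"] by simp
    next
      case False
      then have "0 < Istar_measure T \<mu> y" by (simp add: Istar_measure_def zero_less_measure_iff)
      then show ?thesis by (simp add: powr_divide)
    qed
  qed simp
  also have "\<dots> \<le> q / (q - 1) * (C * measure \<mu> E)"
  proof (rule powr_layer_cake_bound)
    show "0 \<le> ?h y \<and> ?h y \<le> 1" if "y \<in> F" for y
      using le[OF that] by (auto simp: Istar_measure_def divide_le_eq_1 zero_less_measure_iff)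
    show "(\<Sum>y | y \<in> F \<and> t \<le> ?h y. Istar_measure T \<mu> y powr q * \<sigma> y) \<le> C * measure \<mu> E / t" if "0 < t" for t
      using F C E testing that by (rule carleson_weak_type)
  qed (use F q in auto)
  finally show ?thesis .
qed

end

subsection \<open>From the testing condition to the capacity inequality\<close>

text \<open>Treats one test function; the capacity arises later as the infimum over
  \<open>\<phi>\<close>. Since \<open>C > 0\<close>, Young's inequality can be scaled, and since
  \<open>\<mu>\<close> is finite, the energy term can be subtracted.\<close>

lemma admissible_energy_bound:
  fixes T :: "'v rooted_graph" and \<mu> :: "'v point measure" and \<pi> :: "'v \<Rightarrow> real"
  assumes tree: "rooted_tree T" and borel: "finite_borel_measure T \<mu>"
    and \<pi>: "\<And>x. x \<in> verts T \<Longrightarrow> 0 < \<pi> x"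
    and p: "1 < p" and pq: "1 / p + 1 / q = 1" and C: "0 < C" and E: "E \<in> sets \<mu>"
    and testing: "\<And>x G. x \<in> verts T \<Longrightarrow> 0 < Istar_measure T \<mu> x \<Longrightarrow> finite G \<Longrightarrow> G \<subseteq> verts T \<Longrightarrow>
      Vertex ` G \<subseteq> successors T x \<Longrightarrow>
      (\<Sum>y\<in>G. Istar_measure T \<mu> y powr q * \<pi> y powr (1 - q)) \<le> C * Istar_measure T \<mu> x"
    and adm: "admissible T E \<phi>"
  shows "emeasure \<mu> E \<le> ennreal ((p * C) powr (p - 1)) * (\<Sum>\<^sub>\<infinity>x\<in>verts T. ennreal (\<phi> x powr p * \<pi> x))"
proof (cases "(\<Sum>\<^sub>\<infinity>x\<in>verts T. ennreal (\<phi> x powr p * \<pi> x)) = \<infinity>")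
  case True
  then show ?thesis using p C by (simp add: ennreal_mult_top)
next
  case False
  interpret finite_measure \<mu> by (rule finite_mu[OF tree borel])
  define B where "B = (p * C) powr (p - 1)"
  define A where "A = (\<Sum>\<^sub>\<infinity>x\<in>verts T. ennreal (\<phi> x powr p * \<pi> x))"
  \<comment> \<open>As \<open>\<pi>\<close> is positive, this is the support of
    \<open>\<phi>\<close>; finite energy makes it countable, as required by the exchange of sum and
    integral.\<close>
  define D where "D = {x \<in> verts T. \<phi> x powr p * \<pi> x \<noteq> 0}"
  define g where "g y = measure \<mu> (E \<inter> successors T y)" for y
  \<comment> \<open>All follow from \<open>q = p / (p - 1)\<close>; the last one turns the constant
    of \<open>energy_bound\<close> into \<open>p\<close>.\<close>
  have q: "1 < q" and qp: "q / p = q - 1" and pq': "p / q = p - 1" "q / (q - 1) = p"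
  proof -
    have "1 / q = 1 - 1 / p" using pq by simp
    also have "\<dots> = (p - 1) / p" using p by (simp add: field_simps)
    finally have "q = p / (p - 1)" using p by (metis inverse_divide inverse_eq_divide inverse_inverse_eq)
    then have q: "q = p / (p - 1)" .
    have q1: "q - 1 = 1 / (p - 1)" unfolding q using p by (simp add: field_simps)
    then show "1 < q" using p by (smt (verit) divide_pos_pos)
    show "q / p = q - 1" unfolding q1 unfolding q using p by simp
    show "p / q = p - 1" unfolding q using p by simp
    show "q / (q - 1) = p" unfolding q1 unfolding q using p by simp
  qed
  have B: "0 < B" using p C by (simp add: B_def)
  have \<phi>: "0 \<le> \<phi> x" if "x \<in> verts T" for x
    using adm that by (simp add: admissible_def)
  have D: "countable D" "D \<subseteq> verts T"
  proof -
    show "countable D"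
      unfolding D_def using False \<pi>
      by (intro countable_support_ennreal) (auto simp: less_top less_imp_le)
  qed (auto simp: D_def)
  have E_sub: "E \<subseteq> tree_closure T"
    using sets.sets_into_space[OF E] by (simp add: space_mu[OF tree borel])
  have S [measurable]: "successors T y \<in> sets \<mu>" if "y \<in> D" for y
    using that D by (intro sets_mu_successors[OF tree borel]) auto
  \<comment> \<open>A vertex \<open>y\<close> lies on the geodesic to \<open>\<xi>\<close> iff
    \<open>\<xi>\<close> lies in \<open>successors T y\<close>, and vertices outside
    \<open>D\<close> contribute 0.\<close>
  have ge1: "1 \<le> (\<integral>\<^sup>+y. ennreal (\<phi> y) * indicator (successors T y) \<xi> \<partial>count_space D)" if \<xi>: "\<xi> \<in> E" for \<xi>
  proof -
    have cl: "\<xi> \<in> tree_closure T" using E_sub \<xi> by blast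
    have "1 \<le> (\<Sum>\<^sub>\<infinity>y\<in>predecessors T \<xi>. ennreal (\<phi> y))"
      using adm \<xi> by (simp add: admissible_def)
    also have "\<dots> \<le> (\<Sum>\<^sub>\<infinity>y\<in>D. ennreal (\<phi> y) * indicator (successors T y) \<xi>)"
    proof (rule infsum_mono_neutral)
      fix y assume "y \<in> predecessors T \<xi> - D"
      then have "\<phi> y = 0" using predecessors_subset_verts[OF tree cl] \<pi>[of y] by (auto simp: D_def)
      then show "ennreal (\<phi> y) \<le> 0" by simp
    qed (use cl in \<open>auto simp: successors_def indicator_def intro!: nonneg_summable_on_complete\<close>)
    finally show ?thesis using D by (simp add: nn_integral_count_space_eq_infsum)
  qed
  have young: "\<phi> y * g y \<le> B / p * (\<phi> y powr p * \<pi> y) + 1 / (q * p * C) * (g y powr q * \<pi> y powr (1 - q))"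
    if "y \<in> D" for y
  proof -
    have y: "0 \<le> \<phi> y" "0 < \<pi> y" using that D \<phi> \<pi> by auto
    \<comment> \<open>This scaling makes the energy term below absorb exactly \<open>1 / q\<close> of \<open>measure \<mu> E\<close>.\<close>
    define a where "a = (p * C) powr (1 / q) * \<pi> y powr (1 / p)"
    have a: "0 < a" using y p C by (simp add: a_def)
    have ap: "a powr p = B * \<pi> y" and aq: "a powr q = p * C * \<pi> y powr (q - 1)"
      using y p q C pq' qp by (simp_all add: a_def B_def powr_mult powr_powr)
    have "\<phi> y * g y = (a * \<phi> y) * (g y / a)" using a by simp
    also have "\<dots> \<le> (a * \<phi> y) powr p / p + (g y / a) powr q / q"
      using p q pq a y by (intro Youngs_inequality) (auto simp: g_def)
    also have "(a * \<phi> y) powr p = B * (\<phi> y powr p * \<pi> y)"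
      using a y ap by (simp add: powr_mult)
    also have "(g y / a) powr q = 1 / (p * C) * (g y powr q * \<pi> y powr (1 - q))"
    proof -
      have "\<pi> y powr (1 - q) = 1 / \<pi> y powr (q - 1)"
        using y powr_minus_divide[of "\<pi> y" "q - 1"] by simp
      then show ?thesis using a by (simp add: powr_divide aq g_def)
    qed
    finally show ?thesis by (simp add: mult.commute mult.left_commute)
  qed
  have energy: "(\<Sum>\<^sub>\<infinity>y\<in>D. ennreal (g y powr q * \<pi> y powr (1 - q))) \<le> ennreal (p * (C * measure \<mu> E))"
  proof (rule infsum_ennreal_leI)
    fix F assume F: "finite F" "F \<subseteq> D"
    have "(\<Sum>y\<in>F. measure \<mu> (E \<inter> successors T y) powr q * \<pi> y powr (1 - q)) \<le> q / (q - 1) * (C * measure \<mu> E)"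
      using F D C E q by (intro energy_bound[OF tree borel] testing) auto
    then show "(\<Sum>y\<in>F. g y powr q * \<pi> y powr (1 - q)) \<le> p * (C * measure \<mu> E)"
      by (simp add: g_def pq')
  qed simp
  have "emeasure \<mu> E = (\<integral>\<^sup>+\<xi>. indicator E \<xi> * 1 \<partial>\<mu>)" using E by simp
  also have "\<dots> \<le> (\<integral>\<^sup>+\<xi>. indicator E \<xi> * (\<integral>\<^sup>+y. ennreal (\<phi> y) * indicator (successors T y) \<xi> \<partial>count_space D) \<partial>\<mu>)"
    using ge1 by (intro nn_integral_mono) (auto simp: indicator_def)
  also have "\<dots> = (\<integral>\<^sup>+\<xi>. (\<integral>\<^sup>+y. ennreal (\<phi> y) * indicator (E \<inter> successors T y) \<xi> \<partial>count_space D) \<partial>\<mu>)"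
    by (intro nn_integral_cong) (auto simp: indicator_def)
  \<comment> \<open>Tonelli: each \<open>y\<close> now carries \<open>\<phi> y\<close> times the
    mass of \<open>E\<close> below it.\<close>
  also have "\<dots> = (\<integral>\<^sup>+y. (\<integral>\<^sup>+\<xi>. ennreal (\<phi> y) * indicator (E \<inter> successors T y) \<xi> \<partial>\<mu>) \<partial>count_space D)"
    using D E by (intro nn_integral_count_space_nn_integral) auto
  also have "\<dots> = (\<integral>\<^sup>+y. ennreal (\<phi> y * g y) \<partial>count_space D)"
  proof (rule nn_integral_cong)
    fix y assume "y \<in> space (count_space D)"
    then have "(\<integral>\<^sup>+\<xi>. ennreal (\<phi> y) * indicator (E \<inter> successors T y) \<xi> \<partial>\<mu>) = ennreal (\<phi> y) * emeasure \<mu> (E \<inter> successors T y)"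
      using E S by (intro nn_integral_cmult_indicator) auto
    then show "(\<integral>\<^sup>+\<xi>. ennreal (\<phi> y) * indicator (E \<inter> successors T y) \<xi> \<partial>\<mu>) = ennreal (\<phi> y * g y)"
      using \<open>y \<in> space (count_space D)\<close> D \<phi> by (simp add: emeasure_eq_measure g_def ennreal_mult subset_eq)
  qed
  also have "\<dots> \<le> (\<integral>\<^sup>+y. ennreal (B / p) * ennreal (\<phi> y powr p * \<pi> y) +
      ennreal (1 / (q * p * C)) * ennreal (g y powr q * \<pi> y powr (1 - q)) \<partial>count_space D)"
  proof (rule nn_integral_mono)
    fix y assume "y \<in> space (count_space D)"
    then have y: "y \<in> D" "0 \<le> \<pi> y" using D \<pi> by (auto simp: less_imp_le)
    show "ennreal (\<phi> y * g y) \<le> ennreal (B / p) * ennreal (\<phi> y powr p * \<pi> y) +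
      ennreal (1 / (q * p * C)) * ennreal (g y powr q * \<pi> y powr (1 - q))"
      using young[OF y(1)] y(2) p q C B
      by (simp add: ennreal_leI flip: ennreal_mult ennreal_plus)
  qed
  also have "\<dots> = ennreal (B / p) * (\<Sum>\<^sub>\<infinity>y\<in>D. ennreal (\<phi> y powr p * \<pi> y)) +
      ennreal (1 / (q * p * C)) * (\<Sum>\<^sub>\<infinity>y\<in>D. ennreal (g y powr q * \<pi> y powr (1 - q)))"
    using D by (simp add: nn_integral_add nn_integral_cmult nn_integral_count_space_eq_infsum)
  also have "\<dots> \<le> ennreal (B / p) * A + ennreal (1 / (q * p * C)) * ennreal (p * (C * measure \<mu> E))"
    unfolding A_def using energy D
    by (intro add_mono mult_left_mono infsum_mono_neutral nonneg_summable_on_complete) auto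
  also have "ennreal (1 / (q * p * C)) * ennreal (p * (C * measure \<mu> E)) = ennreal (measure \<mu> E / q)"
    using p q C by (simp flip: ennreal_mult)
  finally have main: "emeasure \<mu> E \<le> ennreal (B / p) * A + ennreal (measure \<mu> E / q)" .
  \<comment> \<open>All terms are finite, so the inequality passes to the reals. Subtracting the
    last term leaves \<open>measure \<mu> E / p\<close> on the left, and the factor
    \<open>1 / p\<close> cancels.\<close>
  obtain r where r: "A = ennreal r" "0 \<le> r"
    using False by (cases A) (auto simp: A_def)
  have "ennreal (measure \<mu> E) \<le> ennreal (B / p * r + measure \<mu> E / q)"
    using main r B p q by (simp add: emeasure_eq_measure flip: ennreal_mult ennreal_plus)
  then have "measure \<mu> E \<le> B / p * r + measure \<mu> E / q"
    using B p q r by (subst (asm) ennreal_le_iff) auto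
  moreover have "measure \<mu> E / q = measure \<mu> E - measure \<mu> E / p"
  proof -
    have "1 / q = 1 - 1 / p" using pq by simp
    then have "measure \<mu> E * (1 / q) = measure \<mu> E * (1 - 1 / p)" by simp
    then show ?thesis by (simp add: right_diff_distrib)
  qed
  ultimately have "measure \<mu> E / p \<le> B * r / p" by simp
  then have "measure \<mu> E \<le> B * r" using p by (simp add: divide_le_cancel)
  then show ?thesis
    using r B by (simp add: emeasure_eq_measure B_def A_def ennreal_leI flip: ennreal_mult)
qed

subsection \<open>From the capacity inequality to the testing condition\<close>

lemma sum_mult_indicator_filter:
  fixes f :: "'a \<Rightarrow> real"
  assumes "finite F"
  shows "(\<Sum>y\<in>F. f y * indicator (S y) x) = sum f {y \<in> F. x \<in> S y}"
proof -
  have "(\<Sum>y\<in>F. f y * indicator (S y) x) = (\<Sum>y\<in>F. if x \<in> S y then f y else 0)"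
    by (intro sum.cong) simp_all
  then show ?thesis using sum.inter_filter[OF assms, of f "\<lambda>y. x \<in> S y"] by (simp only:)
qed

context
  fixes T :: "'v rooted_graph" and \<mu> :: "'v point measure" and \<pi> :: "'v \<Rightarrow> real" and p :: real
  assumes tree: "rooted_tree T" and borel: "finite_borel_measure T \<mu>"
    and \<pi>: "\<And>x. x \<in> verts T \<Longrightarrow> 0 < \<pi> x" and p: "1 < p"
begin

text \<open>The potential takes its value from the set of \<open>y \<in> F\<close> above the point.
  The superlevel set is thus a finite union, over \<open>G \<subseteq> F\<close> with
  \<open>t \<le> sum f G\<close>, of intersections of closed successor sets;
  \<open>f \<ge> 0\<close> covers points with further vertices above them.\<close>

lemma closedin_potential_superlevel:
  fixes f :: "'v \<Rightarrow> real"
  assumes F: "finite F" "F \<subseteq> verts T" and f: "\<And>y. y \<in> F \<Longrightarrow> 0 \<le> f y"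
  shows "closedin (closure_topology T)
    {\<xi> \<in> tree_closure T. t \<le> (\<Sum>y\<in>F. f y * indicator (successors T y) \<xi>)}"
proof -
  have sum_eq: "(\<Sum>y\<in>F. f y * indicator (successors T y) \<xi>) = sum f {y \<in> F. \<xi> \<in> successors T y}" for \<xi>
    using F(1) by (rule sum_mult_indicator_filter)
  define \<G> where "\<G> = {G \<in> Pow F. t \<le> sum f G}"
  \<comment> \<open>Inserting the whole closure keeps the intersection inside the space when
    \<open>G\<close> is empty.\<close>
  have "{\<xi> \<in> tree_closure T. t \<le> (\<Sum>y\<in>F. f y * indicator (successors T y) \<xi>)} =
      (\<Union>G\<in>\<G>. \<Inter>(insert (tree_closure T) (successors T ` G)))" (is "?L = ?R")
  proof
    show "?L \<subseteq> ?R"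
    proof
      fix \<xi> assume "\<xi> \<in> ?L"
      then show "\<xi> \<in> ?R"
        by (intro UN_I[of "{y \<in> F. \<xi> \<in> successors T y}"]) (auto simp: \<G>_def sum_eq)
    qed
    show "?R \<subseteq> ?L"
    proof
      fix \<xi> assume "\<xi> \<in> ?R"
      then obtain G where G: "G \<subseteq> F" "t \<le> sum f G" "\<xi> \<in> tree_closure T" "\<forall>y\<in>G. \<xi> \<in> successors T y"
        by (auto simp: \<G>_def)
      have "sum f G \<le> sum f {y \<in> F. \<xi> \<in> successors T y}"
        using F f G by (intro sum_mono2) auto
      then show "\<xi> \<in> ?L" using G by (simp add: sum_eq)
    qed
  qed
  moreover have "closedin (closure_topology T) ?R"
  proof (rule closedin_Union)
    show "finite ((\<lambda>G. \<Inter>(insert (tree_closure T) (successors T ` G))) ` \<G>)"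
      using F by (simp add: \<G>_def)
    fix S assume "S \<in> (\<lambda>G. \<Inter>(insert (tree_closure T) (successors T ` G))) ` \<G>"
    then obtain G where G: "G \<subseteq> F" "S = \<Inter>(insert (tree_closure T) (successors T ` G))"
      by (auto simp: \<G>_def)
    have "closedin (closure_topology T) (tree_closure T)"
      using closedin_topspace[of "closure_topology T"] by (simp add: topspace_closure_topology[OF tree])
    then show "closedin (closure_topology T) S"
      unfolding G(2) using G(1) F closedin_successors[OF tree] by (intro closedin_Inter) auto
  qed
  ultimately show ?thesis by simp
qed

text \<open>The function \<open>f / t\<close>, extended by 0 off \<open>F\<close>, is admissible,
  and its energy is the bound.\<close>

lemma capacity_potential_superlevel:
  fixes f :: "'v \<Rightarrow> real"
  assumes F: "finite F" "F \<subseteq> verts T" and f: "\<And>y. y \<in> F \<Longrightarrow> 0 \<le> f y" and t: "0 < t"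
  shows "capacity T \<pi> p {\<xi> \<in> tree_closure T. t \<le> (\<Sum>y\<in>F. f y * indicator (successors T y) \<xi>)}
    \<le> ennreal ((\<Sum>y\<in>F. f y powr p * \<pi> y) / t powr p)"
proof -
  define \<phi> where "\<phi> y = (if y \<in> F then f y / t else 0)" for y
  let ?E = "{\<xi> \<in> tree_closure T. t \<le> (\<Sum>y\<in>F. f y * indicator (successors T y) \<xi>)}"
  have \<phi>: "0 \<le> \<phi> y" for y using f t by (simp add: \<phi>_def)
  have adm: "admissible T ?E \<phi>"
    unfolding admissible_def
  proof (intro conjI ballI)
    fix \<xi> assume \<xi>: "\<xi> \<in> ?E"
    let ?G = "{y \<in> F. \<xi> \<in> successors T y}"
    have "(\<Sum>y\<in>F. f y * indicator (successors T y) \<xi>) = sum f ?G"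
      using F(1) by (rule sum_mult_indicator_filter)
    then have "t \<le> sum f ?G" using \<xi> by simp
    then have "1 \<le> sum f ?G / t" using t by simp
    also have "\<dots> = sum \<phi> ?G" by (simp add: \<phi>_def sum_divide_distrib)
    finally have "1 \<le> ennreal (sum \<phi> ?G)" by (simp add: ennreal_leI flip: ennreal_1)
    also have "\<dots> \<le> (\<Sum>\<^sub>\<infinity>y\<in>predecessors T \<xi>. ennreal (\<phi> y))"
      using F \<phi> by (intro sum_le_infsum_ennreal) (auto simp: successors_def)
    finally show "1 \<le> (\<Sum>\<^sub>\<infinity>y\<in>predecessors T \<xi>. ennreal (\<phi> y))" .
  qed (rule \<phi>)
  then have "capacity T \<pi> p ?E \<le> (\<Sum>\<^sub>\<infinity>x\<in>verts T. ennreal (\<phi> x powr p * \<pi> x))"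
    unfolding capacity_def by (intro INF_lower) simp
  also have "\<dots> = (\<Sum>\<^sub>\<infinity>x\<in>F. ennreal (\<phi> x powr p * \<pi> x))"
    using F by (intro infsum_cong_neutral) (auto simp: \<phi>_def)
  also have "\<dots> = (\<Sum>x\<in>F. ennreal (\<phi> x powr p * \<pi> x))"
    using F by simp
  also have "\<dots> = ennreal (\<Sum>x\<in>F. \<phi> x powr p * \<pi> x)"
    using F \<pi> by (intro sum_ennreal) (auto simp: less_imp_le)
  also have "(\<Sum>x\<in>F. \<phi> x powr p * \<pi> x) = (\<Sum>y\<in>F. f y powr p * \<pi> y) / t powr p"
    using f t unfolding sum_divide_distrib by (intro sum.cong) (auto simp: \<phi>_def powr_divide)
  finally show ?thesis .
qed

text \<open>The capacitary inequality is a weak-type \<open>(p, p)\<close> bound for the potential of \<open>f\<close>; summing it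
  over dyadic levels above \<open>l\<close> costs only a geometric series of ratio \<open>2 powr (1 - p)\<close>.\<close>

lemma integral_potential_le:
  fixes f :: "'v \<Rightarrow> real"
  assumes F: "finite F" "F \<subseteq> verts T" and f: "\<And>y. y \<in> F \<Longrightarrow> 0 \<le> f y" and l: "0 < l"
    and x: "x \<in> verts T" and Fx: "Vertex ` F \<subseteq> successors T x" and C: "0 \<le> C"
    and cap: "\<And>E. closedin (closure_topology T) E \<Longrightarrow> emeasure \<mu> E \<le> ennreal C * capacity T \<pi> p E"
  shows "(\<Sum>y\<in>F. f y * Istar_measure T \<mu> y) \<le> l * Istar_measure T \<mu> x +
    C * l powr (1 - p) / (1 - 2 powr (1 - p)) * (\<Sum>y\<in>F. f y powr p * \<pi> y)"
proof -
  interpret finite_measure \<mu> by (rule finite_mu[OF tree borel])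
  note S = sets_mu_successors[OF tree borel]
  define s where "s \<xi> = (\<Sum>y\<in>F. f y * indicator (successors T y) \<xi>)" for \<xi>
  define A where "A = (\<Sum>y\<in>F. f y powr p * \<pi> y)"
  define L where "L t = {\<xi> \<in> tree_closure T. t \<le> s \<xi>}" for t
  define r :: real where "r = 2 powr (1 - p)"
  have r: "0 < r" "r < 1" using p by (auto simp: r_def powr_less_one)
  have A: "0 \<le> A" unfolding A_def using F \<pi> by (intro sum_nonneg) (auto simp: less_imp_le)
  have closed: "closedin (closure_topology T) (L t)" for t
    unfolding L_def s_def using F f by (rule closedin_potential_superlevel)
  have L_sets: "L t \<in> sets \<mu>" for t using closed by (rule sets_mu_closedin[OF tree borel])
  have weak: "measure \<mu> (L t) \<le> C * (A / t powr p)" if t: "0 < t" for t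
  proof -
    have "ennreal (measure \<mu> (L t)) \<le> ennreal C * capacity T \<pi> p (L t)"
      using cap[OF closed] by (simp add: emeasure_eq_measure)
    also have "\<dots> \<le> ennreal C * ennreal (A / t powr p)"
      unfolding L_def s_def A_def using F f t
      by (intro mult_left_mono capacity_potential_superlevel) auto
    also have "\<dots> = ennreal (C * (A / t powr p))" using C A by (intro ennreal_mult[symmetric]) auto
    finally show ?thesis using C A by (subst (asm) ennreal_le_iff) auto
  qed
  have s_le: "s \<xi> \<le> sum f F" for \<xi>
    unfolding s_def using f by (intro sum_mono) (auto simp: indicator_def)
  \<comment> \<open>The potential is at most \<open>sum f F\<close>, so finitely many levels
    suffice; \<open>K\<close> disappears when the geometric sum is bounded by its series.\<close>
  obtain K where K: "sum f F / l < 2 ^ K" using real_arch_pow[of 2 "sum f F / l"] by auto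
  \<comment> \<open>The base level \<open>l\<close> is charged only on
    \<open>successors T x\<close>, which later gives the mass below \<open>x\<close> instead of the
    total mass. Elsewhere the potential is 0, as all of \<open>F\<close> lies below
    \<open>x\<close>.\<close>
  have pointwise: "s \<xi> \<le> l * indicator (successors T x) \<xi> + (\<Sum>k<K. 2 ^ k * l * indicator (L (2 ^ k * l)) \<xi>)"
    if \<xi>: "\<xi> \<in> space \<mu>" for \<xi>
  proof (cases "\<xi> \<in> successors T x")
    case True
    have "s \<xi> \<le> 2 ^ K * l" using s_le[of \<xi>] K l by (simp add: field_simps)
    then have "s \<xi> \<le> l + (\<Sum>k<K. 2 ^ k * l * (if 2 ^ k * l \<le> s \<xi> then 1 else 0))"
      by (rule dyadic_layer_bound[OF l])
    moreover have "indicator (L t) \<xi> = (if t \<le> s \<xi> then 1 else (0::real))" for t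
      using \<xi> by (simp add: L_def space_mu[OF tree borel])
    ultimately show ?thesis using True by (simp only: indicator_simps mult_1_right)
  next
    case False
    have "\<xi> \<notin> successors T y" if "y \<in> F" for y
      using successors_mono[OF tree, of y x] Fx that False by auto
    then have "s \<xi> = 0" by (simp add: s_def)
    then show ?thesis using l by (auto intro!: add_nonneg_nonneg sum_nonneg mult_nonneg_nonneg)
  qed
  have ind: "integrable \<mu> (indicator B :: _ \<Rightarrow> real)" if "B \<in> sets \<mu>" for B
    using that by (intro integrable_real_indicator) (auto simp: less_top[symmetric])
  have s_int: "integrable \<mu> s"
    unfolding s_def[abs_def] using F S
    by (intro Bochner_Integration.integrable_sum integrable_mult_right ind) auto
  have "(\<Sum>y\<in>F. f y * Istar_measure T \<mu> y) = (\<Sum>y\<in>F. \<integral>\<xi>. f y * indicator (successors T y) \<xi> \<partial>\<mu>)"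
    using F S by (intro sum.cong) (auto simp: Istar_measure_def)
  also have "\<dots> = (\<integral>\<xi>. s \<xi> \<partial>\<mu>)"
    unfolding s_def using F S
    by (intro Bochner_Integration.integral_sum[symmetric] integrable_mult_right ind) auto
  also have "\<dots> \<le> (\<integral>\<xi>. l * indicator (successors T x) \<xi> + (\<Sum>k<K. 2 ^ k * l * indicator (L (2 ^ k * l)) \<xi>) \<partial>\<mu>)"
    using pointwise S x L_sets
    by (intro integral_mono s_int Bochner_Integration.integrable_add Bochner_Integration.integrable_sum
        integrable_mult_right ind) auto
  also have "\<dots> = (\<integral>\<xi>. l * indicator (successors T x) \<xi> \<partial>\<mu>) +
      (\<integral>\<xi>. (\<Sum>k<K. 2 ^ k * l * indicator (L (2 ^ k * l)) \<xi>) \<partial>\<mu>)"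
    using S x L_sets
    by (intro Bochner_Integration.integral_add Bochner_Integration.integrable_sum integrable_mult_right ind) auto
  also have "(\<integral>\<xi>. (\<Sum>k<K. 2 ^ k * l * indicator (L (2 ^ k * l)) \<xi>) \<partial>\<mu>) =
      (\<Sum>k<K. \<integral>\<xi>. 2 ^ k * l * indicator (L (2 ^ k * l)) \<xi> \<partial>\<mu>)"
    using L_sets by (intro Bochner_Integration.integral_sum integrable_mult_right ind) auto
  also have "(\<integral>\<xi>. l * indicator (successors T x) \<xi> \<partial>\<mu>) = l * Istar_measure T \<mu> x"
    using S[OF x] by (simp add: Istar_measure_def)
  also have "(\<Sum>k<K. \<integral>\<xi>. 2 ^ k * l * indicator (L (2 ^ k * l)) \<xi> \<partial>\<mu>) =
      (\<Sum>k<K. 2 ^ k * l * measure \<mu> (L (2 ^ k * l)))"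
    using L_sets by simp
  \<comment> \<open>At level \<open>t = 2 ^ k * l\<close> the weak bound costs
    \<open>C * A * t powr (1 - p)\<close>, which is geometric in \<open>k\<close> with ratio
    \<open>r\<close>.\<close>
  also have "(\<Sum>k<K. 2 ^ k * l * measure \<mu> (L (2 ^ k * l))) \<le> (\<Sum>k<K. C * l powr (1 - p) * A * r ^ k)"
  proof (rule sum_mono)
    fix k
    have t: "0 < 2 ^ k * l" using l by simp
    have "2 ^ k * l * measure \<mu> (L (2 ^ k * l)) \<le> 2 ^ k * l * (C * (A / (2 ^ k * l) powr p))"
      using t weak by (intro mult_left_mono) auto
    also have "\<dots> = C * A * ((2 ^ k * l) powr (1 - p))"
      using t by (simp add: powr_diff)
    also have "(2 ^ k * l) powr (1 - p) = r ^ k * l powr (1 - p)"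
      using l by (simp add: powr_mult r_def powr_powr flip: powr_realpow) (simp add: mult.commute)
    finally show "2 ^ k * l * measure \<mu> (L (2 ^ k * l)) \<le> C * l powr (1 - p) * A * r ^ k" 
      by (simp add: ac_simps)
  qed
  also have "(\<Sum>k<K. C * l powr (1 - p) * A * r ^ k) = C * l powr (1 - p) * A * (\<Sum>k<K. r ^ k)"
    by (simp add: sum_distrib_left)
  also have "\<dots> \<le> C * l powr (1 - p) * A * (1 / (1 - r))"
  proof (rule mult_left_mono)
    show "(\<Sum>k<K. r ^ k) \<le> 1 / (1 - r)"
      using r sum_le_suminf[of "\<lambda>k. r ^ k" "{..<K}"] by (simp add: suminf_geometric)
  qed (use C A in simp)
  finally show ?thesis by (simp add: A_def r_def)
qed

text \<open>A suitable \<open>f\<close> makes both sums in \<open>integral_potential_le\<close> the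
  same number \<open>A\<close>. It is finite because \<open>F\<close> is, so half of it can be
  absorbed, with a constant independent of \<open>x\<close> and \<open>F\<close>.\<close>

lemma testing_of_capacity_inequality:
  assumes pq: "1 / p + 1 / q = 1" and C: "0 \<le> C"
    and cap: "\<And>E. closedin (closure_topology T) E \<Longrightarrow> emeasure \<mu> E \<le> ennreal C * capacity T \<pi> p E"
  shows "\<exists>C1\<ge>0. \<forall>x\<in>verts T. \<forall>F. finite F \<and> F \<subseteq> verts T \<and> Vertex ` F \<subseteq> successors T x \<longrightarrow>
    (\<Sum>y\<in>F. Istar_measure T \<mu> y powr q * \<pi> y powr (1 - q)) \<le> C1 * Istar_measure T \<mu> x"
proof -
  define d where "d = 1 - (2::real) powr (1 - p)"
  have d: "0 < d" using p by (simp add: d_def powr_less_one)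
  \<comment> \<open>Solves \<open>(C + 1) * l powr (1 - p) / d = 1 / 2\<close>; \<open>C + 1\<close>
    in place of \<open>C\<close> keeps \<open>l\<close> positive when \<open>C = 0\<close>.\<close>
  define l where "l = (2 * (C + 1) / d) powr (1 / (p - 1))"
  have l: "0 < l" using C d by (simp add: l_def)
  have "l powr (1 - p) = (2 * (C + 1) / d) powr (- 1)"
  proof -
    have "1 / (p - 1) * (1 - p) = - 1" using p by (simp add: field_simps)
    then show ?thesis unfolding l_def powr_powr by simp
  qed
  also have "\<dots> = d / (2 * (C + 1))" using C d by (simp add: powr_minus_divide)
  finally have "C * l powr (1 - p) / d = C / (2 * (C + 1))" using d by simp
  also have "\<dots> \<le> 1 / 2" using C by (simp add: divide_le_eq)
  finally have half: "C * l powr (1 - p) / d \<le> 1 / 2" .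
  show ?thesis
  proof (intro exI[of _ "2 * l"] conjI ballI allI impI)
    fix x F assume x: "x \<in> verts T" and F: "finite F \<and> F \<subseteq> verts T \<and> Vertex ` F \<subseteq> successors T x"
    define f where "f y = Istar_measure T \<mu> y powr (q - 1) * \<pi> y powr (1 - q)" for y
    define A where "A = (\<Sum>y\<in>F. Istar_measure T \<mu> y powr q * \<pi> y powr (1 - q))"
    have A: "0 \<le> A" by (simp add: A_def sum_nonneg)
    have e: "(q - 1) * p = q" "(1 - q) * p + 1 = 1 - q"
    proof -
      \<comment> \<open>The case \<open>q = 0\<close> is impossible: \<open>1 / 0 = 0\<close> would
        force \<open>p = 1\<close>.\<close>
      have "p * q = p + q" using pq p by (cases "q = 0") (auto simp: field_simps)
      then show "(q - 1) * p = q" "(1 - q) * p + 1 = 1 - q" by (auto simp: algebra_simps)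
    qed
    have M: "0 \<le> Istar_measure T \<mu> y" for y by (simp add: Istar_measure_def)
    have "(\<Sum>y\<in>F. f y * Istar_measure T \<mu> y) = A"
      unfolding A_def
    proof (rule sum.cong)
      fix y assume "y \<in> F"
      have "Istar_measure T \<mu> y powr (q - 1) * Istar_measure T \<mu> y = Istar_measure T \<mu> y powr q"
        using M[of y] powr_mult_base[of "Istar_measure T \<mu> y" "q - 1"] by (simp add: mult.commute)
      then show "f y * Istar_measure T \<mu> y = Istar_measure T \<mu> y powr q * \<pi> y powr (1 - q)"
        by (simp add: f_def ac_simps)
    qed simp
    moreover have "(\<Sum>y\<in>F. f y powr p * \<pi> y) = A"
      unfolding A_def
    proof (rule sum.cong)
      fix y assume "y \<in> F"
      then have y: "0 < \<pi> y" using F \<pi> by auto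
      have "f y powr p * \<pi> y = Istar_measure T \<mu> y powr q * (\<pi> y powr ((1 - q) * p) * \<pi> y powr 1)"
        using y M by (simp add: f_def powr_mult powr_powr e)
      also have "\<dots> = Istar_measure T \<mu> y powr q * \<pi> y powr (1 - q)"
        unfolding powr_add[symmetric] e ..
      finally show "f y powr p * \<pi> y = Istar_measure T \<mu> y powr q * \<pi> y powr (1 - q)" .
    qed simp
    ultimately have "A \<le> l * Istar_measure T \<mu> x + C * l powr (1 - p) / d * A"
      using integral_potential_le[of F f l x C] F x C cap l by (simp add: f_def d_def)
    also have "C * l powr (1 - p) / d * A \<le> 1 / 2 * A"
      using half A by (rule mult_right_mono)
    finally show "A \<le> 2 * l * Istar_measure T \<mu> x" by simp
  qed (use l in simp)
qed

end

section \<open>Passing between extended suprema or infima and real finite bounds\<close>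

lemma sum_le_of_testing_sup:
  assumes sup: "testing_sup T \<pi> q \<mu> \<le> ennreal C" and C: "0 \<le> C"
    and x: "x \<in> verts T" and pos: "0 < Istar_measure T \<mu> x"
    and G: "finite G" "G \<subseteq> verts T" "Vertex ` G \<subseteq> successors T x"
  shows "(\<Sum>y\<in>G. Istar_measure T \<mu> y powr q * \<pi> y powr (1 - q)) \<le> C * Istar_measure T \<mu> x"
proof -
  let ?M = "ennreal (Istar_measure T \<mu> x)"
  let ?I = "Istar T (\<lambda>y. ennreal (Istar_measure T \<mu> y powr q * \<pi> y powr (1 - q))) x"
  have "?I / ?M \<le> testing_sup T \<pi> q \<mu>"
    unfolding testing_sup_def using x by (rule SUP_upper)
  then have "?I / ?M \<le> ennreal C" using sup by (rule order_trans)
  then have "?I / ?M * ?M \<le> ennreal C * ?M" by (intro mult_right_mono) auto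
  moreover have "?I / ?M * ?M = ?I"
    using pos by (simp add: ennreal_divide_times)
  ultimately have "?I \<le> ennreal (C * Istar_measure T \<mu> x)"
    using C pos by (simp add: ennreal_mult)
  moreover have "ennreal (\<Sum>y\<in>G. Istar_measure T \<mu> y powr q * \<pi> y powr (1 - q)) \<le> ?I"
    unfolding Istar_def using G by (intro sum_le_infsum_ennreal) auto
  ultimately have "ennreal (\<Sum>y\<in>G. Istar_measure T \<mu> y powr q * \<pi> y powr (1 - q))
      \<le> ennreal (C * Istar_measure T \<mu> x)"
    by (rule order_trans[rotated])
  then show ?thesis using C pos by (subst (asm) ennreal_le_iff) auto
qed

text \<open>If the mass below \<open>x\<close> is 0, the bound forces the numerator to be 0 as well
  and the quotient reads \<open>0 / 0 = 0\<close>; otherwise one divides.\<close>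

lemma testing_sup_leI:
  assumes C: "0 \<le> C"
    and testing: "\<And>x F. x \<in> verts T \<Longrightarrow> finite F \<Longrightarrow> F \<subseteq> verts T \<Longrightarrow> Vertex ` F \<subseteq> successors T x \<Longrightarrow>
      (\<Sum>y\<in>F. Istar_measure T \<mu> y powr q * \<pi> y powr (1 - q)) \<le> C * Istar_measure T \<mu> x"
  shows "testing_sup T \<pi> q \<mu> \<le> ennreal C"
  unfolding testing_sup_def
proof (rule SUP_least)
  fix x assume x: "x \<in> verts T"
  let ?M = "ennreal (Istar_measure T \<mu> x)"
  let ?I = "Istar T (\<lambda>y. ennreal (Istar_measure T \<mu> y powr q * \<pi> y powr (1 - q))) x"
  have "?I \<le> ennreal (C * Istar_measure T \<mu> x)"
    unfolding Istar_def using x by (intro infsum_ennreal_leI testing) auto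
  then have le: "?I \<le> ?M * ennreal C"
    using C by (simp add: ennreal_mult Istar_measure_def mult.commute)
  show "?I / ?M \<le> ennreal C"
  proof (cases "?M = 0")
    case True
    then have "?I = 0" using le by simp
    then show ?thesis by simp
  next
    case False
    then show ?thesis using le by (intro divide_le_posI_ennreal) (auto simp: zero_less_iff_neq_zero)
  qed
qed

text \<open>Dividing by \<open>C\<close> gives a lower bound for the infimum; as \<open>C\<close> is
  positive and finite, it can be multiplied back.\<close>

lemma le_mult_capacityI:
  assumes "0 < C" and "\<And>\<phi>. admissible T E \<phi> \<Longrightarrow> m \<le> ennreal C * (\<Sum>\<^sub>\<infinity>x\<in>verts T. ennreal (\<phi> x powr p * \<pi> x))"
  shows "m \<le> ennreal C * capacity T \<pi> p E"
proof -
  have "m / ennreal C \<le> capacity T \<pi> p E"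
    unfolding capacity_def
    using assms by (intro INF_greatest divide_le_posI_ennreal) auto
  then have "ennreal C * (m / ennreal C) \<le> ennreal C * capacity T \<pi> p E"
    by (intro mult_left_mono) auto
  moreover have "ennreal C * (m / ennreal C) = m"
    using assms(1) ennreal_divide_times[of m "ennreal C" "ennreal C"] by (simp add: mult.commute)
  ultimately show ?thesis by simp
qed

theorem theorem43:
  fixes T :: "'v rooted_graph" and N :: nat and \<pi> :: "'v \<Rightarrow> real"
    and p p' :: real and \<mu> :: "'v point measure"
  assumes "rooted_tree T"
    and "\<And>x. x \<in> verts T \<Longrightarrow>
           finite (children T x) \<and> 1 \<le> card (children T x) \<and> card (children T x) \<le> N"
    and "\<And>x. x \<in> verts T \<Longrightarrow> 0 < \<pi> x"
    and "1 < p" and "1 / p + 1 / p' = 1"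
    and "finite_borel_measure T \<mu>"
  shows "(\<forall>C1::real. 0 \<le> C1 \<and> testing_sup T \<pi> p' \<mu> \<le> ennreal C1 \<longrightarrow>
            (\<exists>C2::real. 0 \<le> C2 \<and> C2 \<le> p powr (p - 1) * C1 powr (p - 1) \<and>
               (\<forall>E. closedin (closure_topology T) E \<longrightarrow>
                      emeasure \<mu> E \<le> ennreal C2 * capacity T \<pi> p E))) \<and>
         ((\<exists>C2::real. 0 \<le> C2 \<and>
             (\<forall>E. closedin (closure_topology T) E \<longrightarrow>
                    emeasure \<mu> E \<le> ennreal C2 * capacity T \<pi> p E)) \<longrightarrow>
            (\<exists>C1::real. 0 \<le> C1 \<and> testing_sup T \<pi> p' \<mu> \<le> ennreal C1))"
proof (intro conjI allI impI)
  note tree = assms(1) and \<pi> = assms(3) and p = assms(4) and pq = assms(5) and borel = assms(6)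
  fix C1 :: real assume "0 \<le> C1 \<and> testing_sup T \<pi> p' \<mu> \<le> ennreal C1"
  then have C1: "0 \<le> C1" and sup: "testing_sup T \<pi> p' \<mu> \<le> ennreal C1" by auto
  note testing = sum_le_of_testing_sup[OF sup C1]
  show "\<exists>C2::real. 0 \<le> C2 \<and> C2 \<le> p powr (p - 1) * C1 powr (p - 1) \<and>
    (\<forall>E. closedin (closure_topology T) E \<longrightarrow> emeasure \<mu> E \<le> ennreal C2 * capacity T \<pi> p E)"
  proof (cases "C1 = 0")
    \<comment> \<open>Treated apart because the Young scaling divides by the constant. The permitted
      \<open>C2\<close> is now 0, since \<open>0 powr (p - 1) = 0\<close>, so \<open>\<mu>\<close>
      has to vanish.\<close>
    case True
    have o: "origin T \<in> verts T" by (rule origin_in_verts[OF tree])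
    have zero: "Istar_measure T \<mu> (origin T) = 0"
    proof (rule ccontr)
      assume "Istar_measure T \<mu> (origin T) \<noteq> 0"
      then have pos: "0 < Istar_measure T \<mu> (origin T)" by (simp add: Istar_measure_def zero_less_measure_iff)
      \<comment> \<open>Testing at the root with the root as only term suffices, since its successor
        set is the whole closure.\<close>
      have "(\<Sum>y\<in>{origin T}. Istar_measure T \<mu> y powr p' * \<pi> y powr (1 - p')) \<le> C1 * Istar_measure T \<mu> (origin T)"
        using o pos by (intro testing) (auto simp: successors_origin[OF tree] tree_closure_def)
      moreover have "0 < Istar_measure T \<mu> (origin T) powr p' * \<pi> (origin T) powr (1 - p')"
        using pos \<pi>[OF o] by simp
      ultimately show False using True by simp
    qed
    have "emeasure \<mu> E = 0" if "closedin (closure_topology T) E" for E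
    proof -
      interpret finite_measure \<mu> by (rule finite_mu[OF tree borel])
      have "emeasure \<mu> E \<le> emeasure \<mu> (space \<mu>)" by (rule emeasure_space)
      also have "\<dots> = 0"
        using zero by (simp add: Istar_measure_def successors_origin[OF tree] space_mu[OF tree borel] emeasure_eq_measure)
      finally show ?thesis by simp
    qed
    then show ?thesis by (intro exI[of _ 0]) auto
  next
    case False
    then have C1: "0 < C1" using C1 by simp
    have "emeasure \<mu> E \<le> ennreal ((p * C1) powr (p - 1)) * capacity T \<pi> p E"
      if "closedin (closure_topology T) E" for E
    proof (rule le_mult_capacityI)
      fix \<phi> assume "admissible T E \<phi>"
      with tree borel \<pi> p pq C1 sets_mu_closedin[OF tree borel that] testing
      show "emeasure \<mu> E \<le> ennreal ((p * C1) powr (p - 1)) * (\<Sum>\<^sub>\<infinity>x\<in>verts T. ennreal (\<phi> x powr p * \<pi> x))"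
        by (rule admissible_energy_bound)
    qed (use p C1 in simp)
    moreover have "(p * C1) powr (p - 1) = p powr (p - 1) * C1 powr (p - 1)"
      using p C1 by (simp add: powr_mult)
    ultimately show ?thesis by (intro exI[of _ "(p * C1) powr (p - 1)"]) auto
  qed
next
  note tree = assms(1) and \<pi> = assms(3) and p = assms(4) and pq = assms(5) and borel = assms(6)
  assume "\<exists>C2::real. 0 \<le> C2 \<and>
    (\<forall>E. closedin (closure_topology T) E \<longrightarrow> emeasure \<mu> E \<le> ennreal C2 * capacity T \<pi> p E)"
  then obtain C2 where "0 \<le> C2"
    "\<And>E. closedin (closure_topology T) E \<Longrightarrow> emeasure \<mu> E \<le> ennreal C2 * capacity T \<pi> p E"
    by blast
  from testing_of_capacity_inequality[OF tree borel \<pi> p pq this]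
  obtain C1 where "0 \<le> C1" and C1: "\<forall>x\<in>verts T. \<forall>F. finite F \<and> F \<subseteq> verts T \<and> Vertex ` F \<subseteq> successors T x \<longrightarrow>
    (\<Sum>y\<in>F. Istar_measure T \<mu> y powr p' * \<pi> y powr (1 - p')) \<le> C1 * Istar_measure T \<mu> x"
    by blast
  show "\<exists>C1::real. 0 \<le> C1 \<and> testing_sup T \<pi> p' \<mu> \<le> ennreal C1"
  proof (intro exI conjI)
    show "testing_sup T \<pi> p' \<mu> \<le> ennreal C1"
      using \<open>0 \<le> C1\<close> C1 by (intro testing_sup_leI) auto
  qed fact
qed

end
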